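(* Let $M$ be a preGarside monoid, let $S$ be a generating set for $M$ that does not contain $1$, let $\Gamma_L=\Gamma_L(S,M)$ be the graph with vertex set $S$ in which $\{a,b\}$ is an edge if and only if $a\neq b$ and $a\vee_L b$ exists in $M$, and let $f_L$ be a left selector on $S$ in $M$. Then $M\simeq M_L(\Gamma_L,f_L)$.
   Context: For a monoid $M$: $b\preceq_L a$ means $a=bc$ for some $c\in M$; $c\preceq_R a$ means $a=bc$ for some $b\in M$. $M$ is cancellative if $cad=cbd$ implies $a=b$. $M$ is atomic if there is a map $\nu:M\to\mathbb{N}$ with $\nu(a)>0$ for $a\ne 1$ and $\nu(ab)\ge\nu(a)+\nu(b)$. A preGarside monoid is a cancellative atomic monoid $M$ such that, for all $a,b\in M$, if $a,b$ have a common upper bound for $\preceq_L$ then they have a least one, $a\vee_L b$, and if they have a common upper bound for $\preceq_R$ then they have a least one, $a\vee_R b$. Let $\Gamma$ be a simple undirected graph with vertex set $S$ and edge set $E(\Gamma)$, and let $\hat E(\Gamma)=\{(a,b)\in S\times S\mid\{a,b\}\in E(\Gamma)\}$. A partial complement on $S$ based on $\Gamma$ is a map $f:\hat E(\Gamma)\to S^*$ into the free monoid on $S$. The monoid associated to $f$ on the left is given by the monoid presentation $$M_L(\Gamma,f)=\langle S\mid x\,f(x,y)=y\,f(y,x)\text{ for }\{x,y\}\in E(\Gamma)\rangle^+.$$ A left selector on $S$ in $M$ is a partial complement $f_L$ on $S$ based on $\Gamma_L(S,M)$ such that, for all $\{x,y\}\in E(\Gamma_L)$, the words $x\,f_L(x,y)$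 and $y\,f_L(y,x)$ represent $x\vee_L y$ in $M$. *)

theory Defs
  imports "HOL-Algebra.Group" "HOL-Algebra.Lattice"
begin

subsection \<open>PreGarside monoids\<close>

definition le_L :: "('a, 'm) monoid_scheme \<Rightarrow> 'a \<Rightarrow> 'a \<Rightarrow> bool" where
  "le_L M b a \<longleftrightarrow> (\<exists>c\<in>carrier M. a = b \<otimes>\<^bsub>M\<^esub> c)"

definition le_R :: "('a, 'm) monoid_scheme \<Rightarrow> 'a \<Rightarrow> 'a \<Rightarrow> bool" where
  "le_R M c a \<longleftrightarrow> (\<exists>b\<in>carrier M. a = b \<otimes>\<^bsub>M\<^esub> c)"

definition order_L :: "('a, 'm) monoid_scheme \<Rightarrow> 'a gorder" where
  "order_L M = \<lparr>carrier = carrier M, eq = (=), le = le_L M\<rparr>"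

definition order_R :: "('a, 'm) monoid_scheme \<Rightarrow> 'a gorder" where
  "order_R M = \<lparr>carrier = carrier M, eq = (=), le = le_R M\<rparr>"

definition join_exists :: "('a, 'm) gorder_scheme \<Rightarrow> 'a \<Rightarrow> 'a \<Rightarrow> bool" where
  "join_exists L a b \<longleftrightarrow> (\<exists>c. least L c (Upper L {a, b}))"

definition cancellative :: "('a, 'm) monoid_scheme \<Rightarrow> bool" where
  "cancellative M \<longleftrightarrow>
    (\<forall>a\<in>carrier M. \<forall>b\<in>carrier M. \<forall>c\<in>carrier M. \<forall>d\<in>carrier M.
      c \<otimes>\<^bsub>M\<^esub> a \<otimes>\<^bsub>M\<^esub> d = c \<otimes>\<^bsub>M\<^esub> b \<otimes>\<^bsub>M\<^esub> d \<longrightarrow> a = b)"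

definition atomic_monoid :: "('a, 'm) monoid_scheme \<Rightarrow> bool" where
  "atomic_monoid M \<longleftrightarrow>
    (\<exists>\<nu> :: 'a \<Rightarrow> nat.
      (\<forall>a\<in>carrier M. a \<noteq> \<one>\<^bsub>M\<^esub> \<longrightarrow> \<nu> a > 0) \<and>
      (\<forall>a\<in>carrier M. \<forall>b\<in>carrier M. \<nu> (a \<otimes>\<^bsub>M\<^esub> b) \<ge> \<nu> a + \<nu> b))"

locale preGarside_monoid = monoid M for M (structure) +
  assumes cancellative: "cancellative M"
    and atomic: "atomic_monoid M"
    and join_L: "\<lbrakk>a \<in> carrier M; b \<in> carrier M; Upper (order_L M) {a, b} \<noteq> {}\<rbrakk>
      \<Longrightarrow> join_exists (order_L M) a b"
    and join_R: "\<lbrakk>a \<in> carrier M; b \<in> carrier M; Upper (order_R M) {a, b} \<noteq> {}\<rbrakk>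
      \<Longrightarrow> join_exists (order_R M) a b"

text \<open>The library's join is chosen by Hilbert choice; antisymmetry makes it unique.\<close>

lemma (in preGarside_monoid) l_cancel':
  assumes "a \<in> carrier M" "b \<in> carrier M" "c \<in> carrier M" "c \<otimes> a = c \<otimes> b"
  shows "a = b"
proof -
  have "c \<otimes> a \<otimes> \<one> = c \<otimes> b \<otimes> \<one>" using assms by simp
  then show ?thesis using cancellative assms one_closed unfolding cancellative_def by blast
qed

lemma (in preGarside_monoid) mult_eq_oneD:
  assumes "a \<in> carrier M" "b \<in> carrier M" "a \<otimes> b = \<one>"
  shows "a = \<one>"
proof -
  obtain \<nu> :: "'a \<Rightarrow> nat"
    where pos: "\<And>x. x \<in> carrier M \<Longrightarrow> x \<noteq> \<one> \<Longrightarrow> \<nu> x > 0"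
      and add: "\<And>x y. x \<in> carrier M \<Longrightarrow> y \<in> carrier M \<Longrightarrow> \<nu> (x \<otimes> y) \<ge> \<nu> x + \<nu> y"
    using atomic unfolding atomic_monoid_def by blast
  have "\<nu> \<one> = 0" using add[of \<one> \<one>] by simp
  moreover have "\<nu> a + \<nu> b \<le> \<nu> \<one>" using add[of a b] assms by simp
  ultimately show ?thesis using pos[of a] assms by auto
qed

lemma (in preGarside_monoid) partial_order_order_L: "partial_order (order_L M)"
proof
  fix x y assume xy: "x \<in> carrier (order_L M)" "y \<in> carrier (order_L M)"
    "x \<sqsubseteq>\<^bsub>order_L M\<^esub> y" "y \<sqsubseteq>\<^bsub>order_L M\<^esub> x"
  then obtain c d where cd: "c \<in> carrier M" "d \<in> carrier M" "y = x \<otimes> c" "x = y \<otimes> d"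
    and x: "x \<in> carrier M"
    by (auto simp: order_L_def le_L_def)
  have "x \<otimes> c \<otimes> d = x" using cd(3,4) by metis
  then have "x \<otimes> (c \<otimes> d) = x \<otimes> \<one>" using cd(1,2) x by (simp add: m_assoc)
  then have "c \<otimes> d = \<one>" using l_cancel'[of "c \<otimes> d" \<one> x] cd(1,2) x by simp
  then have "c = \<one>" using mult_eq_oneD cd(1,2) by blast
  then show "x .=\<^bsub>order_L M\<^esub> y" using cd(3) x by (simp add: order_L_def)
next
  fix x y z
  assume "x \<in> carrier (order_L M)" "x \<sqsubseteq>\<^bsub>order_L M\<^esub> y" "y \<sqsubseteq>\<^bsub>order_L M\<^esub> z"
  then obtain c d where "c \<in> carrier M" "d \<in> carrier M" "y = x \<otimes> c" "z = y \<otimes> d"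
    "x \<in> carrier M"
    by (auto simp: order_L_def le_L_def)
  then have "c \<otimes> d \<in> carrier M" "z = x \<otimes> (c \<otimes> d)" by (simp_all add: m_assoc)
  then show "x \<sqsubseteq>\<^bsub>order_L M\<^esub> z" by (auto simp: order_L_def le_L_def)
next
  fix x assume "x \<in> carrier (order_L M)"
  then have "x \<in> carrier M" by (simp add: order_L_def)
  then have "\<exists>c\<in>carrier M. x = x \<otimes> c" by (intro bexI[of _ \<one>]) simp_all
  then show "x \<sqsubseteq>\<^bsub>order_L M\<^esub> x" by (simp add: order_L_def le_L_def)
qed (simp_all add: order_L_def)

subsection \<open>Words, generating sets and presentations\<close>

definition generates :: "('a, 'm) monoid_scheme \<Rightarrow> 'a set \<Rightarrow> bool" where
  "generates M S \<longleftrightarrow> S \<subseteq> carrier M \<and> (\<forall>H. submonoid H M \<and> S \<subseteq> H \<longrightarrow> H = carrier M)"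

definition word_val :: "('a, 'm) monoid_scheme \<Rightarrow> 'a list \<Rightarrow> 'a" where
  "word_val M w = foldr (\<lambda>x y. x \<otimes>\<^bsub>M\<^esub> y) w \<one>\<^bsub>M\<^esub>"

text \<open>The free monoid on \<open>S\<close> is \<open>lists S\<close> under concatenation.\<close>

inductive_set gen_cong :: "'a set \<Rightarrow> ('a list \<times> 'a list) set \<Rightarrow> ('a list \<times> 'a list) set"
  for S :: "'a set" and R :: "('a list \<times> 'a list) set" where
  base: "\<lbrakk>(u, v) \<in> R; u \<in> lists S; v \<in> lists S\<rbrakk> \<Longrightarrow> (u, v) \<in> gen_cong S R"
| refl: "u \<in> lists S \<Longrightarrow> (u, u) \<in> gen_cong S R"
| sym: "(u, v) \<in> gen_cong S R \<Longrightarrow> (v, u) \<in> gen_cong S R"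
| trans: "\<lbrakk>(u, v) \<in> gen_cong S R; (v, w) \<in> gen_cong S R\<rbrakk> \<Longrightarrow> (u, w) \<in> gen_cong S R"
| mult: "\<lbrakk>(u, v) \<in> gen_cong S R; (u', v') \<in> gen_cong S R\<rbrakk> \<Longrightarrow> (u @ u', v @ v') \<in> gen_cong S R"

definition presented_monoid :: "'a set \<Rightarrow> ('a list \<times> 'a list) set \<Rightarrow> 'a list set monoid" where
  "presented_monoid S R =
    \<lparr>carrier = lists S // gen_cong S R,
     mult = (\<lambda>A B. \<Union>u\<in>A. \<Union>v\<in>B. gen_cong S R `` {u @ v}),
     one = gen_cong S R `` {[]}\<rparr>"

lemma gen_cong_lists: "(u, v) \<in> gen_cong S R \<Longrightarrow> u \<in> lists S \<and> v \<in> lists S"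
  by (induction rule: gen_cong.induct) auto

lemma equiv_gen_cong: "equiv (lists S) (gen_cong S R)"
proof (rule equivI)
  show "gen_cong S R \<subseteq> lists S \<times> lists S" using gen_cong_lists by fastforce
  show "refl_on (lists S) (gen_cong S R)" by (rule refl_onI) (rule gen_cong.refl)
  show "sym (gen_cong S R)" by (rule symI) (rule gen_cong.sym)
  show "trans (gen_cong S R)" by (rule transI) (rule gen_cong.trans)
qed

lemma presented_monoid_mult_class:
  assumes "u \<in> lists S" "v \<in> lists S"
  shows "gen_cong S R `` {u} \<otimes>\<^bsub>presented_monoid S R\<^esub> gen_cong S R `` {v}
    = gen_cong S R `` {u @ v}"
proof -
  have "congruent2 (gen_cong S R) (gen_cong S R) (\<lambda>u v. gen_cong S R `` {u @ v})"
    by (rule congruent2I')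
      (simp add: equiv_class_eq[OF equiv_gen_cong] gen_cong.mult)
  from UN_equiv_class2[OF equiv_gen_cong equiv_gen_cong this assms]
  show ?thesis by (simp add: presented_monoid_def)
qed

lemma monoid_presented_monoid: "monoid (presented_monoid S R)"
proof -
  let ?P = "presented_monoid S R"
  have car: "x \<in> carrier ?P \<longleftrightarrow> (\<exists>u\<in>lists S. x = gen_cong S R `` {u})" for x
    by (auto simp: presented_monoid_def quotient_def)
  have one: "\<one>\<^bsub>?P\<^esub> = gen_cong S R `` {[]}"
    by (simp add: presented_monoid_def)
  show ?thesis
  proof
    fix x y assume "x \<in> carrier ?P" "y \<in> carrier ?P"
    then obtain u v where "u \<in> lists S" "v \<in> lists S"
      "x = gen_cong S R `` {u}" "y = gen_cong S R `` {v}"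
      by (auto simp: car)
    then show "x \<otimes>\<^bsub>?P\<^esub> y \<in> carrier ?P"
      unfolding car by (intro bexI[of _ "u @ v"]) (simp_all add: presented_monoid_mult_class)
  next
    fix x y z assume "x \<in> carrier ?P" "y \<in> carrier ?P" "z \<in> carrier ?P"
    then obtain u v w where "u \<in> lists S" "v \<in> lists S" "w \<in> lists S"
      "x = gen_cong S R `` {u}" "y = gen_cong S R `` {v}" "z = gen_cong S R `` {w}"
      by (auto simp: car)
    then show "x \<otimes>\<^bsub>?P\<^esub> y \<otimes>\<^bsub>?P\<^esub> z = x \<otimes>\<^bsub>?P\<^esub> (y \<otimes>\<^bsub>?P\<^esub> z)"
      by (simp add: presented_monoid_mult_class)
  next
    show "\<one>\<^bsub>?P\<^esub> \<in> carrier ?P" by (auto simp: car one intro!: bexI[of _ "[]"])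
  next
    fix x assume "x \<in> carrier ?P"
    then obtain u where "u \<in> lists S" "x = gen_cong S R `` {u}" by (auto simp: car)
    then show "\<one>\<^bsub>?P\<^esub> \<otimes>\<^bsub>?P\<^esub> x = x" "x \<otimes>\<^bsub>?P\<^esub> \<one>\<^bsub>?P\<^esub> = x"
      by (simp_all add: one presented_monoid_mult_class)
  qed
qed

subsection \<open>Graphs and complements\<close>

record 'v ugraph =
  verts :: "'v set"
  edges :: "'v set set"

definition simple_graph :: "('v, 'm) ugraph_scheme \<Rightarrow> bool" where
  "simple_graph G \<longleftrightarrow> (\<forall>e\<in>edges G. e \<subseteq> verts G \<and> card e = 2)"

definition oriented_edges :: "('v, 'm) ugraph_scheme \<Rightarrow> ('v \<times> 'v) set" where
  "oriented_edges G = {(a, b) \<in> verts G \<times> verts G. {a, b} \<in> edges G}"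

text \<open>Values of \<open>f\<close> off the oriented edges are never used.\<close>

definition partial_complement :: "('v, 'm) ugraph_scheme \<Rightarrow> ('v \<times> 'v \<Rightarrow> 'v list) \<Rightarrow> bool" where
  "partial_complement G f \<longleftrightarrow> simple_graph G \<and> f \<in> oriented_edges G \<rightarrow> lists (verts G)"

definition M_L :: "('v, 'm) ugraph_scheme \<Rightarrow> ('v \<times> 'v \<Rightarrow> 'v list) \<Rightarrow> 'v list set monoid" where
  "M_L G f = presented_monoid (verts G)
    {(x # f (x, y), y # f (y, x)) | x y. {x, y} \<in> edges G}"

definition Gamma_L :: "'a set \<Rightarrow> ('a, 'm) monoid_scheme \<Rightarrow> 'a ugraph" where
  "Gamma_L S M =
    \<lparr>verts = S,
     edges = {{a, b} | a b. a \<in> S \<and> b \<in> S \<and> a \<noteq> b \<and> join_exists (order_L M) a b}\<rparr>"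

lemma simple_graph_Gamma_L: "simple_graph (Gamma_L S M)"
  by (auto simp: simple_graph_def Gamma_L_def)

definition left_selector ::
  "'a set \<Rightarrow> ('a, 'm) monoid_scheme \<Rightarrow> ('a \<times> 'a \<Rightarrow> 'a list) \<Rightarrow> bool" where
  "left_selector S M f \<longleftrightarrow>
    partial_complement (Gamma_L S M) f \<and>
    (\<forall>x y. {x, y} \<in> edges (Gamma_L S M) \<longrightarrow>
      word_val M (x # f (x, y)) = x \<squnion>\<^bsub>order_L M\<^esub> y \<and>
      word_val M (y # f (y, x)) = x \<squnion>\<^bsub>order_L M\<^esub> y)"

end

theory Submission
  imports Defs
begin

text \<open>
  Evaluation of words \<open>lists S \<rightarrow> M\<close> is a surjective homomorphism, so \<open>M\<close> is the quotient of the
  free monoid on \<open>S\<close> by the kernel of evaluation, and the claim is that this kernel is the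
  congruence generated by the relations \<open>x f(x,y) = y f(y,x)\<close>
  (\<open>iso_presented_monoid\<close>). The relations hold in \<open>M\<close> because both sides represent
  \<open>x \<squnion> y\<close> (\<open>gen_cong_word_val\<close>).

  Conversely, let \<open>x u\<close> and \<open>y v\<close> be words with the same value \<open>a\<close> (\<open>word_val_eq_imp_gen_cong\<close>).
  If \<open>x = y\<close>, then \<open>u\<close> and \<open>v\<close> have the same value by cancellation. Otherwise \<open>a\<close> is a common
  upper bound of \<open>x\<close> and \<open>y\<close>, so \<open>x \<squnion> y\<close> exists and divides \<open>a\<close>, say
  \<open>a = (x \<squnion> y) c\<close> with \<open>c\<close> the value of a word \<open>w\<close>. Cancelling \<open>x\<close> shows that \<open>u\<close> and
  \<open>f(x,y) w\<close> have the same value; likewise for \<open>v\<close> and \<open>f(y,x) w\<close>. These values have smaller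
  norm than \<open>a\<close>, since generators are nontrivial and so have positive norm. By induction on the norm,
  \<open>x u\<close> is congruent to \<open>x f(x,y) w\<close>, which one relation turns into \<open>y f(y,x) w\<close>,
  which is congruent to \<open>y v\<close>. The empty word is alone in its fibre, because a product equal
  to \<open>1\<close> has trivial factors.
\<close>

section \<open>Evaluation of words\<close>

lemma word_val_Nil: "word_val M [] = \<one>\<^bsub>M\<^esub>"
  by (simp add: word_val_def)

lemma word_val_Cons: "word_val M (x # w) = x \<otimes>\<^bsub>M\<^esub> word_val M w"
  by (simp add: word_val_def)

lemma (in monoid) word_val_closed:
  assumes "S \<subseteq> carrier G" "w \<in> lists S"
  shows "word_val G w \<in> carrier G"
  using assms(2) by (induction w) (use assms(1) in \<open>auto simp: word_val_Nil word_val_Cons\<close>)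

lemma (in monoid) word_val_append:
  assumes "S \<subseteq> carrier G" "u \<in> lists S" "v \<in> lists S"
  shows "word_val G (u @ v) = word_val G u \<otimes> word_val G v"
  using assms(2)
proof (induction u)
  case Nil
  then show ?case using word_val_closed assms by (simp add: word_val_Nil)
next
  case (Cons x u)
  have "x \<in> carrier G" "word_val G u \<in> carrier G" "word_val G v \<in> carrier G"
    using Cons.prems Cons.hyps assms word_val_closed by auto
  then show ?case using Cons by (simp add: word_val_Cons m_assoc)
qed

lemma (in monoid) generates_imp_word:
  assumes "generates G S" "a \<in> carrier G"
  obtains w where "w \<in> lists S" "word_val G w = a"
proof -
  let ?H = "word_val G ` lists S"
  have S: "S \<subseteq> carrier G" using assms(1) by (simp add: generates_def)
  have "submonoid ?H G"
  proof
    show "?H \<subseteq> carrier G" using word_val_closed[OF S] by blast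
    show "\<one> \<in> ?H" by (rule image_eqI[of _ _ "[]"]) (simp_all add: word_val_Nil)
    show "x \<otimes> y \<in> ?H" if xy: "x \<in> ?H" "y \<in> ?H" for x y
    proof -
      obtain u v where "u \<in> lists S" "v \<in> lists S" "x = word_val G u" "y = word_val G v"
        using xy by blast
      then show ?thesis using word_val_append[OF S]
        by (intro image_eqI[of _ _ "u @ v"]) simp_all
    qed
  qed
  moreover have "S \<subseteq> ?H"
  proof
    fix x assume "x \<in> S"
    then show "x \<in> ?H" using S
      by (intro image_eqI[of _ _ "[x]"]) (auto simp: word_val_Nil word_val_Cons)
  qed
  ultimately have "a \<in> ?H" using assms by (simp add: generates_def)
  then show ?thesis by (rule imageE) (rule that, simp_all)
qed

lemma (in monoid) gen_cong_word_val:
  assumes S: "S \<subseteq> carrier G"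
    and R: "\<And>u v. (u, v) \<in> R \<Longrightarrow> word_val G u = word_val G v"
    and uv: "(u, v) \<in> gen_cong S R"
  shows "word_val G u = word_val G v"
  using uv
proof induction
  case (base u v)
  then show ?case using R by blast
next
  case (mult u v u' v')
  then have "u \<in> lists S" "v \<in> lists S" "u' \<in> lists S" "v' \<in> lists S"
    using gen_cong_lists by metis+
  then show ?case using mult.IH by (simp add: word_val_append[OF S])
qed simp_all

section \<open>Presentations and the kernel of evaluation\<close>

text \<open>First isomorphism theorem for monoids: the isomorphism sends an element of the monoid to the
  fibre of evaluation over it, which is a congruence class.\<close>

lemma (in monoid) iso_presented_monoid:
  assumes gen: "generates G S"
    and kernel: "\<And>u v. u \<in> lists S \<Longrightarrow> v \<in> lists S \<Longrightarrow>
      (u, v) \<in> gen_cong S R \<longleftrightarrow> word_val G u = word_val G v"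
  shows "G \<cong> presented_monoid S R"
proof -
  let ?h = "\<lambda>a. {w \<in> lists S. word_val G w = a}"
  have S: "S \<subseteq> carrier G" using gen by (simp add: generates_def)
  have cls: "?h (word_val G w) = gen_cong S R `` {w}" if "w \<in> lists S" for w
  proof (rule Set.set_eqI)
    fix v
    have "v \<in> ?h (word_val G w) \<longleftrightarrow> (w, v) \<in> gen_cong S R"
      using kernel[OF that, of v] gen_cong_lists[of w v S R]
      by (metis (mono_tags, lifting) mem_Collect_eq)
    then show "v \<in> ?h (word_val G w) \<longleftrightarrow> v \<in> gen_cong S R `` {w}" by simp
  qed
  have mem: "?h a \<in> carrier (presented_monoid S R)" if "a \<in> carrier G" for a
  proof -
    obtain w where "w \<in> lists S" "word_val G w = a"
      using generates_imp_word[OF gen \<open>a \<in> carrier G\<close>] .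
    then show ?thesis using cls[of w] by (simp add: presented_monoid_def quotientI)
  qed
  have "?h \<in> hom G (presented_monoid S R)"
  proof (rule homI)
    fix a assume "a \<in> carrier G"
    then show "?h a \<in> carrier (presented_monoid S R)"
      by (rule mem)
  next
    fix a b assume "a \<in> carrier G" "b \<in> carrier G"
    then obtain u v where u: "u \<in> lists S" "word_val G u = a"
      and v: "v \<in> lists S" "word_val G v = b"
      using generates_imp_word[OF gen] by metis
    have "?h (a \<otimes> b) = gen_cong S R `` {u @ v}"
      using cls[of "u @ v"] u v by (simp add: word_val_append[OF S])
    also have "\<dots> = ?h a \<otimes>\<^bsub>presented_monoid S R\<^esub> ?h b"
      using cls[OF u(1)] cls[OF v(1)] u v by (simp add: presented_monoid_mult_class)
    finally show "?h (a \<otimes> b) = ?h a \<otimes>\<^bsub>presented_monoid S R\<^esub> ?h b" .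
  qed
  moreover have "bij_betw ?h (carrier G) (carrier (presented_monoid S R))"
  proof (rule bij_betwI')
    fix a b assume "a \<in> carrier G" "b \<in> carrier G"
    then obtain w where "w \<in> lists S" "word_val G w = a" using generates_imp_word[OF gen] by metis
    then show "?h a = ?h b \<longleftrightarrow> a = b" by blast
  next
    fix a assume "a \<in> carrier G"
    then show "?h a \<in> carrier (presented_monoid S R)"
      by (rule mem)
  next
    fix A assume "A \<in> carrier (presented_monoid S R)"
    then obtain w where "w \<in> lists S" "A = gen_cong S R `` {w}"
      by (auto simp: presented_monoid_def quotient_def)
    then show "\<exists>a\<in>carrier G. A = ?h a"
      using cls[of w] word_val_closed[OF S, of w] by (intro bexI[of _ "word_val G w"]) simp_all
  qed
  ultimately show ?thesis unfolding is_iso_def iso_def by blast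
qed

section \<open>Joins and the word problem in preGarside monoids\<close>

text \<open>The library's join is a chosen least upper bound, hence a least upper bound
  as soon as one exists.\<close>

lemma least_join:
  assumes "join_exists L a b"
  shows "least L (a \<squnion>\<^bsub>L\<^esub> b) (Upper L {a, b})"
  using assms unfolding join_exists_def Lattice.join_def Lattice.sup_def by (rule someI_ex)

context preGarside_monoid
begin

lemma Upper_order_L_iff:
  assumes "x \<in> carrier M" "y \<in> carrier M"
  shows "a \<in> Upper (order_L M) {x, y} \<longleftrightarrow> a \<in> carrier M \<and> le_L M x a \<and> le_L M y a"
  using assms by (auto simp: Upper_def order_L_def)

lemma join_divides_common_multiple:
  assumes "x \<in> carrier M" "y \<in> carrier M" "a \<in> carrier M" "le_L M x a" "le_L M y a"
  shows "join_exists (order_L M) x y" and "le_L M (x \<squnion>\<^bsub>order_L M\<^esub> y) a"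
proof -
  have a: "a \<in> Upper (order_L M) {x, y}" using assms by (simp add: Upper_order_L_iff)
  then show "join_exists (order_L M) x y" using join_L assms(1,2) by blast
  from least_join[OF this] a show "le_L M (x \<squnion>\<^bsub>order_L M\<^esub> y) a"
    by (auto simp: least_def order_L_def)
qed

text \<open>The induction is on the norm of the common value and
  not on the length of a word: the word \<open>f(x,y) w\<close> with which the tail of \<open>u\<close> is compared
  may be longer than \<open>u\<close>, but its value has smaller norm.\<close>

lemma word_val_eq_imp_gen_cong:
  assumes gen: "generates M S" and one: "\<one> \<notin> S" and sel: "left_selector S M f"
    and "u \<in> lists S" "v \<in> lists S" "word_val M u = word_val M v"
  shows "(u, v) \<in> gen_cong S {(x # f (x, y), y # f (y, x)) | x y. {x, y} \<in> edges (Gamma_L S M)}"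
    (is "_ \<in> gen_cong S ?R")
proof -
  have S: "S \<subseteq> carrier M" using gen by (simp add: generates_def)
  note closed = word_val_closed[OF S]
  obtain \<nu> :: "'a \<Rightarrow> nat"
    where pos: "\<And>a. a \<in> carrier M \<Longrightarrow> a \<noteq> \<one> \<Longrightarrow> \<nu> a > 0"
      and add: "\<And>a b. a \<in> carrier M \<Longrightarrow> b \<in> carrier M \<Longrightarrow> \<nu> (a \<otimes> b) \<ge> \<nu> a + \<nu> b"
    using atomic unfolding atomic_monoid_def by blast
  have smaller: "\<nu> (word_val M w) < \<nu> (word_val M (x # w))" if "x \<in> S" "w \<in> lists S" for x w
  proof -
    have "x \<in> carrier M" "x \<noteq> \<one>" using that S one by auto
    then show ?thesis
      using pos[of x] add[of x "word_val M w"] closed[OF that(2)] by (simp add: word_val_Cons)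
  qed
  have not_Nil: "word_val M (x # w) \<noteq> \<one>" if "x \<in> S" "w \<in> lists S" for x w
    using mult_eq_oneD[of x "word_val M w"] that S one closed by (auto simp: word_val_Cons)
  have cons: "(x # p, x # q) \<in> gen_cong S ?R"
    if "x \<in> S" "(p, q) \<in> gen_cong S ?R" for x p q
    using gen_cong.mult[OF gen_cong.refl[of "[x]"] that(2)] that(1) by simp
  show ?thesis
    using assms(4-6)
  proof (induction "\<nu> (word_val M u)" arbitrary: u v rule: less_induct)
    case less
    have IH: "(p, q) \<in> gen_cong S ?R"
      if "\<nu> (word_val M p) < \<nu> (word_val M u)" "p \<in> lists S" "q \<in> lists S"
        "word_val M p = word_val M q" for p q
      using less.hyps that by blast
    show ?case
    proof (cases u)
      case Nil
      then have "v = []" using less.prems not_Nil by (cases v) (auto simp: word_val_Nil)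
      then show ?thesis using Nil gen_cong.refl by blast
    next
      case (Cons x p)
      note u = this
      then have xp: "x \<in> S" "p \<in> lists S" using less.prems by auto
      obtain y q where v: "v = y # q"
        using less.prems not_Nil[OF xp] u by (cases v) (auto simp: word_val_Nil)
      then have yq: "y \<in> S" "q \<in> lists S" using less.prems by auto
      have car: "x \<in> carrier M" "y \<in> carrier M" using xp yq S by auto
      let ?a = "word_val M u"
      have ax: "?a = x \<otimes> word_val M p" using u by (simp add: word_val_Cons)
      have ay: "?a = y \<otimes> word_val M q" using less.prems v by (simp add: word_val_Cons)
      show ?thesis
      proof (cases "x = y")
        case True
        then have "word_val M p = word_val M q"
          using l_cancel'[of "word_val M p" "word_val M q" x] ax ay closed xp yq car by metis
        then have "(p, q) \<in> gen_cong S ?R"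
          using IH smaller[OF xp] xp yq u by simp
        then show ?thesis using cons xp u v True by simp
      next
        case False
        let ?j = "x \<squnion>\<^bsub>order_L M\<^esub> y"
        have "le_L M x ?a" "le_L M y ?a"
          unfolding le_L_def using ax ay closed xp yq by blast+
        note join = join_divides_common_multiple[OF car closed[OF less.prems(1)] this]
        have edge: "{x, y} \<in> edges (Gamma_L S M)"
          using False join(1) xp yq by (auto simp: Gamma_L_def)
        then have edge': "{y, x} \<in> edges (Gamma_L S M)" by (simp add: insert_commute)
        have f: "f (x, y) \<in> lists S" "f (y, x) \<in> lists S"
          using sel edge edge' xp yq
          by (auto simp: left_selector_def partial_complement_def oriented_edges_def
              Gamma_L_def Pi_iff)
        have fj: "x \<otimes> word_val M (f (x, y)) = ?j" "y \<otimes> word_val M (f (y, x)) = ?j"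
          using sel edge unfolding left_selector_def word_val_Cons by blast+
        \<comment> \<open>The words \<open>x f(x,y) w\<close> and \<open>y f(y,x) w\<close> interpolate between \<open>u\<close> and \<open>v\<close>:
          they differ by one relation, and each shares its first letter with \<open>u\<close> or \<open>v\<close>.\<close>
        obtain c where c: "c \<in> carrier M" "?a = ?j \<otimes> c"
          using join(2) by (auto simp: le_L_def)
        obtain w where w: "w \<in> lists S" "word_val M w = c"
          using generates_imp_word[OF gen c(1)] .
        have split: "z \<otimes> word_val M (g @ w) = z \<otimes> word_val M g \<otimes> c"
          if "z \<in> carrier M" "g \<in> lists S" for z g
          using that w c(1) closed by (simp add: word_val_append[OF S] m_assoc)
        have pw: "word_val M p = word_val M (f (x, y) @ w)"
          by (rule l_cancel'[of _ _ x])
            (use split[OF car(1) f(1)] ax c(2) fj closed xp f w car in auto)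
        have qw: "word_val M q = word_val M (f (y, x) @ w)"
          by (rule l_cancel'[of _ _ y])
            (use split[OF car(2) f(2)] ay c(2) fj closed yq f w car in auto)
        have "(p, f (x, y) @ w) \<in> gen_cong S ?R"
          using IH[OF _ _ _ pw] smaller[OF xp] xp f w u by simp
        then have "(u, x # f (x, y) @ w) \<in> gen_cong S ?R" using cons xp u by simp
        moreover have "(x # f (x, y), y # f (y, x)) \<in> gen_cong S ?R"
          using edge xp yq f by (intro gen_cong.base) auto
        then have "(x # f (x, y) @ w, y # f (y, x) @ w) \<in> gen_cong S ?R"
          using gen_cong.mult[OF _ gen_cong.refl[OF w(1)]] by fastforce
        moreover have "(q, f (y, x) @ w) \<in> gen_cong S ?R"
          using IH[OF _ _ _ qw] smaller[OF yq] yq f w v less.prems by simp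
        then have "(y # f (y, x) @ w, v) \<in> gen_cong S ?R"
          using gen_cong.sym[OF cons[OF yq(1)]] v by simp
        ultimately show ?thesis by (rule gen_cong.trans[OF gen_cong.trans])
      qed
    qed
  qed
qed

end

theorem theorem2p6:
  fixes M :: "('a, 'm) monoid_scheme" and S :: "'a set"
    and f\<^sub>L :: "'a \<times> 'a \<Rightarrow> 'a list"
  assumes "preGarside_monoid M"
    and "generates M S"
    and "\<one>\<^bsub>M\<^esub> \<notin> S"
    and "left_selector S M f\<^sub>L"
  shows "M \<cong> M_L (Gamma_L S M) f\<^sub>L"
proof -
  interpret preGarside_monoid M by fact
  let ?R = "{(x # f\<^sub>L (x, y), y # f\<^sub>L (y, x)) | x y. {x, y} \<in> edges (Gamma_L S M)}"
  have S: "S \<subseteq> carrier M" using assms(2) by (simp add: generates_def)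
  have rel: "word_val M u = word_val M v" if in_R: "(u, v) \<in> ?R" for u v
  proof -
    obtain x y where uv: "u = x # f\<^sub>L (x, y)" "v = y # f\<^sub>L (y, x)"
      and edge: "{x, y} \<in> edges (Gamma_L S M)"
      using in_R by blast
    have "word_val M (x # f\<^sub>L (x, y)) = x \<squnion>\<^bsub>order_L M\<^esub> y"
      "word_val M (y # f\<^sub>L (y, x)) = x \<squnion>\<^bsub>order_L M\<^esub> y"
      using assms(4) edge unfolding left_selector_def by blast+
    then show ?thesis unfolding uv by simp
  qed
  have "M \<cong> presented_monoid S ?R"
  proof (rule iso_presented_monoid[OF assms(2)])
    fix u v assume uv: "u \<in> lists S" "v \<in> lists S"
    show "(u, v) \<in> gen_cong S ?R \<longleftrightarrow> word_val M u = word_val M v"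
    proof
      show "word_val M u = word_val M v" if "(u, v) \<in> gen_cong S ?R"
        by (rule gen_cong_word_val[OF S _ that]) (rule rel)
    qed (rule word_val_eq_imp_gen_cong[OF assms(2-4) uv])
  qed
  moreover have "verts (Gamma_L S M) = S" by (simp add: Gamma_L_def)
  ultimately show ?thesis unfolding M_L_def by (simp only:)
qed

end
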